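(* Let $\mathbf{k}$ be a commutative ring, $q\in\mathbf{k}$ and $r:=q+1$, and assume that $r$ is invertible in $\mathbf{k}$. (a) The family $\left(\eta_\alpha^{*(q)}\right)_{\alpha\in\mathrm{Comp}}$ is the basis of $\mathrm{NSym}$ dual to the basis $\left(\eta_\alpha^{(q)}\right)_{\alpha\in\mathrm{Comp}}$ of $\mathrm{QSym}$ with respect to the bilinear form $\langle\cdot,\cdot\rangle$. Concretely: $\left(\eta_\alpha^{*(q)}\right)_{\alpha\in\mathrm{Comp}}$ is a graded basis of $\mathrm{NSym}$ and satisfies $\left\langle\eta_\alpha^{*(q)},\eta_\beta^{(q)}\right\rangle=[\alpha=\beta]$ for all $\alpha,\beta\in\mathrm{Comp}$. (b) Let $n\in\mathbb{N}$, and let $\mathrm{QSym}_n$ and $\mathrm{NSym}_n$ be the $n$-th graded components of $\mathrm{QSym}$ and $\mathrm{NSym}$. Then the family $\left(\eta_\alpha^{*(q)}\right)_{\alpha\in\mathrm{Comp}_n}$ is the basis of $\mathrm{NSym}_n$ dual to the basis $\left(\eta_\alpha^{(q)}\right)_{\alpha\in\mathrm{Comp}_n}$ of $\mathrm{QSym}_n$ with respect to the bilinear form $\langle\cdot,\cdot\rangle$.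
   Context: $\mathbb{N}=\{0,1,2,\ldots\}$; for an integer $m$, $[m]=\{1,2,\ldots,m\}$ (empty if $m\le 0$). For a statement $\mathcal{A}$, $[\mathcal{A}]$ is its truth value ($1$ if true, $0$ if false). A composition is a finite tuple $\alpha=(\alpha_1,\ldots,\alpha_k)$ of positive integers; its length is $\ell(\alpha)=k$, its size is $|\alpha|=\alpha_1+\cdots+\alpha_k$. $\mathrm{Comp}$ is the set of all compositions (including the empty one), and $\mathrm{Comp}_n$ the set of compositions of size $n$. For $\alpha=(\alpha_1,\ldots,\alpha_k)\in\mathrm{Comp}_n$ set $D(\alpha)=\{\alpha_1+\cdots+\alpha_i \mid i\in[k-1]\}\subseteq[n-1]$. $\mathrm{QSym}\subseteq\mathbf{k}[[x_1,x_2,\ldots]]$ is the graded algebra of quasisymmetric functions over $\mathbf{k}$, with basis $(M_\alpha)_{\alpha\in\mathrm{Comp}}$ where $M_\alpha=\sum_{i_1<\cdots<i_\ell}x_{i_1}^{\alpha_1}\cdots x_{i_\ell}^{\alpha_\ell}$ for $\alpha=(\alpha_1,\ldots,\alpha_\ell)$. For $\alpha\in\mathrm{Comp}_n$, $\eta_\alpha^{(q)}=\sum_{\beta\in\mathrm{Comp}_n;\ D(\beta)\subseteq D(\alpha)}r^{\ell(\beta)}M_\beta$; since $r$ is invertible, $(\eta_\alpha^{(q)})_{\alpha\in\mathrm{Comp}}$ is a basis of $\mathrm{QSym}$. $\mathrm{NSym}$ is the free (noncommutative) $\mathbf{k}$-algebra with generators $H_1,H_2,H_3,\ldots$, graded so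 that $H_n$ has degree $n$. For $\alpha=(\alpha_1,\ldots,\alpha_k)\in\mathrm{Comp}$, $H_\alpha=H_{\alpha_1}H_{\alpha_2}\cdots H_{\alpha_k}$; the family $(H_\alpha)_{\alpha\in\mathrm{Comp}}$ is a basis of $\mathrm{NSym}$. The $\mathbf{k}$-bilinear form $\langle\cdot,\cdot\rangle:\mathrm{NSym}\times\mathrm{QSym}\to\mathbf{k}$ is defined by $\langle H_\alpha,M_\beta\rangle=[\alpha=\beta]$ for all $\alpha,\beta\in\mathrm{Comp}$. For $\alpha\in\mathrm{Comp}_n$, $\eta_\alpha^{*(q)}=\sum_{\beta\in\mathrm{Comp}_n;\ D(\alpha)\subseteq D(\beta)}\frac{1}{r^{\ell(\beta)}}(-1)^{\ell(\beta)-\ell(\alpha)}H_\beta\in\mathrm{NSym}$. A graded basis indexed by $\mathrm{Comp}$ means a basis such that, for each $n$, the subfamily indexed by $\mathrm{Comp}_n$ is a basis of the $n$-th graded component. *)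

theory Defs
  imports Complex_Main "HOL-Library.Poly_Mapping"
begin

section \<open>Compositions\<close>

typedef composition = "{xs :: nat list. 0 \<notin> set xs}"
  morphisms parts Abs_composition
  by (rule exI[of _ "[]"]) simp

setup_lifting type_definition_composition

lift_definition clength :: "composition \<Rightarrow> nat" is length .

lift_definition csize :: "composition \<Rightarrow> nat" is sum_list .

definition Comp :: "nat \<Rightarrow> composition set" where
  "Comp n = {\<alpha>. csize \<alpha> = n}"

definition D :: "composition \<Rightarrow> nat set" where
  "D \<alpha> = {sum_list (take i (parts \<alpha>)) | i. i \<in> {1..clength \<alpha> - 1}}"

text \<open>Concatenation makes compositions the free monoid on the positive integers.\<close>

instantiation composition :: monoid_add
begin
lift_definition zero_composition :: composition is "[]" by simp
lift_definition plus_composition :: "composition \<Rightarrow> composition \<Rightarrow> composition" is "(@)" by simp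
instance by standard (transfer, simp)+
end

lemma parts_pos: "0 \<notin> set (parts \<alpha>)"
  using parts[of \<alpha>] by simp

lemma finite_Comp: "finite (Comp n)"
proof -
  have *: "length xs \<le> sum_list xs" if "0 \<notin> set xs" for xs :: "nat list"
    using that by (induction xs) auto
  have "parts ` Comp n \<subseteq> {xs. set xs \<subseteq> {..n} \<and> length xs \<le> n}"
  proof (intro subsetI, elim imageE)
    fix xs \<alpha> assume "xs = parts \<alpha>" "\<alpha> \<in> Comp n"
    then have "sum_list xs = n" "0 \<notin> set xs"
      using parts_pos by (auto simp: Comp_def csize.rep_eq)
    then show "xs \<in> {xs. set xs \<subseteq> {..n} \<and> length xs \<le> n}"
      using *[of xs] by (auto dest: member_le_sum_list)
  qed
  then have "finite (parts ` Comp n)"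
    by (rule finite_subset) (rule finite_lists_length_le, simp)
  then show ?thesis
    by (rule finite_imageD) (auto intro!: inj_onI simp: parts_inject)
qed


section \<open>Bases of modules over a commutative ring\<close>

context module
begin

definition basis_family :: "'i set \<Rightarrow> ('i \<Rightarrow> 'b) \<Rightarrow> 'b set \<Rightarrow> bool" where
  "basis_family I v V \<longleftrightarrow> inj_on v I \<and> independent (v ` I) \<and> span (v ` I) = V"

end


section \<open>Noncommutative symmetric functions\<close>

text \<open>
  The monoid algebra of the free monoid on the positive integers, that is, the free algebra on
  \<open>H\<^sub>1, H\<^sub>2, \<dots>\<close>: the word \<open>H\<^bsub>\<alpha>1\<^esub> \<dots> H\<^bsub>\<alpha>k\<^esub>\<close> is the
  monomial with key \<open>(\<alpha>\<^sub>1, \<dots>, \<alpha>\<^sub>k)\<close>. The product is the convolution product of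
  \<^type>\<open>poly_mapping\<close>.
\<close>

type_synonym 'k nsym = "composition \<Rightarrow>\<^sub>0 'k"

definition nscale :: "'k \<Rightarrow> 'k nsym \<Rightarrow> 'k::comm_ring_1 nsym" where
  "nscale c = Poly_Mapping.map ((*) c)"

lemma lookup_nscale: "Poly_Mapping.lookup (nscale c x) \<alpha> = c * Poly_Mapping.lookup x \<alpha>"
  by (simp add: nscale_def Poly_Mapping.map.rep_eq when_def)

interpretation nsym: module nscale
  by standard (auto intro!: poly_mapping_eqI simp: lookup_nscale lookup_add algebra_simps)

text \<open>Only meant for \<open>n \<ge> 1\<close>.\<close>

definition Hgen :: "nat \<Rightarrow> 'k::comm_ring_1 nsym" where
  "Hgen n = Poly_Mapping.single (Abs_composition [n]) 1"

definition H :: "composition \<Rightarrow> 'k::comm_ring_1 nsym" where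
  "H \<alpha> = prod_list (map Hgen (parts \<alpha>))"

definition NSym_deg :: "nat \<Rightarrow> 'k::comm_ring_1 nsym set" where
  "NSym_deg n = {x. \<forall>\<alpha>\<in>Poly_Mapping.keys x. csize \<alpha> = n}"

lemma H_eq_single: "H \<alpha> = Poly_Mapping.single \<alpha> 1"
proof -
  have "prod_list (map Hgen xs) = (Poly_Mapping.single (Abs_composition xs) 1 :: 'k::comm_ring_1 nsym)"
    if "0 \<notin> set xs" for xs
    using that
  proof (induction xs)
    case Nil
    then show ?case by (simp flip: zero_composition_def)
  next
    case (Cons x xs)
    then have "Abs_composition [x] + Abs_composition xs = Abs_composition (x # xs)"
      by (simp add: plus_composition.abs_eq eq_onp_def)
    with Cons show ?case by (simp add: Hgen_def mult_single)
  qed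
  from this[OF parts_pos[of \<alpha>]] show ?thesis by (simp add: H_def parts_inverse)
qed


section \<open>Quasisymmetric functions\<close>

text \<open>
  A power series in countably many commuting variables is its family of coefficients, indexed by
  monomials; a monomial is its finitely supported exponent function. The variables are indexed
  from 0, in the same order as \<open>x\<^sub>1, x\<^sub>2, \<dots>\<close>. Only the module structure is needed here.
\<close>

typedef (overloaded) 'k mpowser = "UNIV :: ((nat \<Rightarrow>\<^sub>0 nat) \<Rightarrow> 'k) set"
  morphisms mcoeff Abs_mpowser ..

setup_lifting type_definition_mpowser

lemma mpowser_eqI: "(\<And>m. mcoeff f m = mcoeff g m) \<Longrightarrow> f = g"
  by transfer auto

instantiation mpowser :: (ab_group_add) ab_group_add
begin
lift_definition zero_mpowser :: "'a mpowser" is "\<lambda>_. 0" .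
lift_definition plus_mpowser :: "'a mpowser \<Rightarrow> 'a mpowser \<Rightarrow> 'a mpowser"
  is "\<lambda>f g m. f m + g m" .
lift_definition minus_mpowser :: "'a mpowser \<Rightarrow> 'a mpowser \<Rightarrow> 'a mpowser"
  is "\<lambda>f g m. f m - g m" .
lift_definition uminus_mpowser :: "'a mpowser \<Rightarrow> 'a mpowser" is "\<lambda>f m. - f m" .
instance by standard (transfer, simp add: fun_eq_iff algebra_simps)+
end

lift_definition mscale :: "'k \<Rightarrow> 'k mpowser \<Rightarrow> 'k::comm_ring_1 mpowser" is "\<lambda>c f m. c * f m" .

interpretation mpowser: module mscale
  by standard (transfer, simp add: fun_eq_iff algebra_simps)+

text \<open>\<open>xmon [i\<^sub>1, \<dots>, i\<^sub>k] [a\<^sub>1, \<dots>, a\<^sub>k]\<close> is the monomial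
  \<open>x\<^bsub>i1\<^esub>\<^bsup>a1\<^esup> \<dots> x\<^bsub>ik\<^esub>\<^bsup>ak\<^esup>\<close>.\<close>

definition xmon :: "nat list \<Rightarrow> nat list \<Rightarrow> (nat \<Rightarrow>\<^sub>0 nat)" where
  "xmon is as = (\<Sum>(i, a)\<leftarrow>zip is as. Poly_Mapping.single i a)"

definition mdegree :: "(nat \<Rightarrow>\<^sub>0 nat) \<Rightarrow> nat" where
  "mdegree m = (\<Sum>i\<in>Poly_Mapping.keys m. Poly_Mapping.lookup m i)"

definition QSym :: "'k::comm_ring_1 mpowser set" where
  "QSym = {f. (\<exists>d. \<forall>m. mcoeff f m \<noteq> 0 \<longrightarrow> mdegree m \<le> d) \<and>
     (\<forall>\<alpha> is js. length is = clength \<alpha> \<and> length js = clength \<alpha> \<and>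
        sorted_wrt (<) is \<and> sorted_wrt (<) js \<longrightarrow>
        mcoeff f (xmon is (parts \<alpha>)) = mcoeff f (xmon js (parts \<alpha>)))}"

definition QSym_deg :: "nat \<Rightarrow> 'k::comm_ring_1 mpowser set" where
  "QSym_deg n = {f \<in> QSym. \<forall>m. mcoeff f m \<noteq> 0 \<longrightarrow> mdegree m = n}"

text \<open>The coefficient of a monomial in the formal sum
  \<open>\<Sum> x\<^bsub>i1\<^esub>\<^bsup>\<alpha>1\<^esup> \<dots> x\<^bsub>ik\<^esub>\<^bsup>\<alpha>k\<^esup>\<close>
  over \<open>i\<^sub>1 < \<dots> < i\<^sub>k\<close> is the number of index tuples producing that monomial.\<close>

lift_definition M :: "composition \<Rightarrow> 'k::comm_ring_1 mpowser" is
  "\<lambda>\<alpha> m. of_nat (card {is. length is = clength \<alpha> \<and> sorted_wrt (<) is \<and> xmon is (parts \<alpha>) = m})" .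


section \<open>The pairing\<close>

lemma nsym_sum_single:
  "x = (\<Sum>\<alpha>\<in>Poly_Mapping.keys x. nscale (Poly_Mapping.lookup x \<alpha>) (H \<alpha>))"
proof (rule poly_mapping_eqI)
  fix \<beta>
  have "Poly_Mapping.lookup (\<Sum>\<alpha>\<in>Poly_Mapping.keys x. nscale (Poly_Mapping.lookup x \<alpha>) (H \<alpha>)) \<beta> =
      (\<Sum>\<alpha>\<in>Poly_Mapping.keys x. if \<alpha> = \<beta> then Poly_Mapping.lookup x \<beta> else 0)"
    unfolding lookup_sum
    by (intro sum.cong refl) (simp add: lookup_nscale H_eq_single lookup_single when_def)
  also have "\<dots> = Poly_Mapping.lookup x \<beta>"
    by (simp add: in_keys_iff)
  finally show "Poly_Mapping.lookup x \<beta> =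
      Poly_Mapping.lookup (\<Sum>\<alpha>\<in>Poly_Mapping.keys x. nscale (Poly_Mapping.lookup x \<alpha>) (H \<alpha>)) \<beta>" ..
qed

lemma H_basis: "nsym.basis_family UNIV (H :: composition \<Rightarrow> 'k::comm_ring_1 nsym) UNIV"
proof -
  let ?H = "H :: composition \<Rightarrow> 'k nsym"
  have inj: "inj ?H"
    by (rule injI) (metis H_eq_single lookup_single_eq lookup_single_not_eq zero_neq_one)
  have "nsym.independent (range ?H)"
    unfolding nsym.independent_explicit_module
  proof (intro allI impI)
    fix t :: "'k nsym set" and u v
    assume t: "finite t" "t \<subseteq> range ?H" and z: "(\<Sum>v\<in>t. nscale (u v) v) = 0" and v: "v \<in> t"
    then obtain \<alpha> where \<alpha>: "v = H \<alpha>" by blast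
    have "0 = Poly_Mapping.lookup (\<Sum>v\<in>t. nscale (u v) v) \<alpha>" by (simp add: z)
    also have "\<dots> = (\<Sum>w\<in>t. if w = v then u v else 0)"
      unfolding lookup_sum
    proof (rule sum.cong)
      fix w assume "w \<in> t"
      then obtain \<beta> where "w = H \<beta>" using t by blast
      then show "Poly_Mapping.lookup (nscale (u w) w) \<alpha> = (if w = v then u v else 0)"
        using injD[OF inj, of \<beta> \<alpha>]
        by (cases "\<beta> = \<alpha>") (simp_all add: \<alpha> lookup_nscale, simp_all add: H_eq_single lookup_single)
    qed simp
    also have "\<dots> = u v" using t v by simp
    finally show "u v = 0" by simp
  qed
  moreover have "x \<in> nsym.span (range ?H)" for x
    by (subst nsym_sum_single) (intro nsym.span_sum nsym.span_scale nsym.span_base, simp)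
  ultimately show ?thesis using inj by (auto simp: nsym.basis_family_def)
qed

lemma
  assumes "sorted_wrt (<) is" "length is = length as"
  shows map_lookup_xmon: "map (Poly_Mapping.lookup (xmon is as)) is = as"
    and keys_xmon_subset: "Poly_Mapping.keys (xmon is as) \<subseteq> set is"
    and keys_xmon: "0 \<notin> set as \<Longrightarrow> Poly_Mapping.keys (xmon is as) = set is"
proof -
  have *: "Poly_Mapping.keys (xmon is as) \<subseteq> set is \<and> map (Poly_Mapping.lookup (xmon is as)) is = as"
    using assms(2,1)
  proof (induction "is" as rule: list_induct2)
    case (Cons i js a as)
    have [simp]: "xmon (i # js) (a # as) = Poly_Mapping.single i a + xmon js as"
      by (simp add: xmon_def)
    have i: "i \<notin> set js" using Cons by auto
    then have 0: "Poly_Mapping.lookup (xmon js as) i = 0"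
      using Cons by (auto simp: in_keys_iff)
    have "map (Poly_Mapping.lookup (xmon (i # js) (a # as))) js = map (Poly_Mapping.lookup (xmon js as)) js"
      using i by (auto simp: lookup_add lookup_single when_def)
    moreover have "Poly_Mapping.keys (xmon (i # js) (a # as)) \<subseteq> set (i # js)"
      using Poly_Mapping.keys_add[of "Poly_Mapping.single i a" "xmon js as"] Cons
      by (auto split: if_splits)
    moreover have "Poly_Mapping.lookup (xmon (i # js) (a # as)) i = a"
      using 0 by (simp add: lookup_add)
    ultimately show ?case using Cons by (simp del: map_eq_conv)
  qed (simp add: xmon_def)
  then show a: "map (Poly_Mapping.lookup (xmon is as)) is = as"
    and b: "Poly_Mapping.keys (xmon is as) \<subseteq> set is" by auto
  assume 0: "0 \<notin> set as"
  have "set is \<subseteq> Poly_Mapping.keys (xmon is as)"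
  proof
    fix i assume "i \<in> set is"
    then have "Poly_Mapping.lookup (xmon is as) i \<in> set as"
      by (subst a[symmetric]) simp
    then show "i \<in> Poly_Mapping.keys (xmon is as)" using 0 by (metis in_keys_iff)
  qed
  with b show "Poly_Mapping.keys (xmon is as) = set is" by blast
qed

lemma xmon_eqD:
  assumes "xmon is as = xmon js bs" "sorted_wrt (<) is" "sorted_wrt (<) js"
    "length is = length as" "length js = length bs" "0 \<notin> set as" "0 \<notin> set bs"
  shows "is = js" "as = bs"
proof -
  have "set is = set js" using keys_xmon[of "is" as] keys_xmon[of js bs] assms by simp
  then show "is = js" using assms by (simp add: strict_sorted_equal)
  then show "as = bs"
    using map_lookup_xmon[OF assms(2,4)] map_lookup_xmon[OF assms(3,5)] assms(1) by metis
qed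

lemma xmon_exists:
  obtains "is" \<alpha> where "sorted_wrt (<) is" "length is = clength \<alpha>" "m = xmon is (parts \<alpha>)"
proof -
  define js where "js = sorted_list_of_set (Poly_Mapping.keys m)"
  define as where "as = map (Poly_Mapping.lookup m) js"
  have s: "sorted_wrt (<) js" by (simp add: js_def)
  have 0: "0 \<notin> set as" by (auto simp: as_def js_def in_keys_iff)
  have "m = xmon js as"
  proof (rule poly_mapping_eqI)
    fix i
    show "Poly_Mapping.lookup m i = Poly_Mapping.lookup (xmon js as) i"
    proof (cases "i \<in> set js")
      case True
      have "map (Poly_Mapping.lookup (xmon js as)) js = map (Poly_Mapping.lookup m) js"
        using map_lookup_xmon[OF s, of as] by (simp add: as_def)
      with True show ?thesis by simp
    next
      case False
      then have "i \<notin> Poly_Mapping.keys m" "i \<notin> Poly_Mapping.keys (xmon js as)"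
        using keys_xmon_subset[OF s, of as] by (auto simp: js_def as_def)
      then show ?thesis by (simp add: in_keys_iff)
    qed
  qed
  moreover have "parts (Abs_composition as) = as" using 0 by (simp add: Abs_composition_inverse)
  moreover have "length js = length as" by (simp add: as_def)
  ultimately show thesis using that[OF s, of "Abs_composition as"] by (metis clength.rep_eq)
qed

lemma mdegree_xmon:
  assumes "sorted_wrt (<) is" "length is = clength \<alpha>"
  shows "mdegree (xmon is (parts \<alpha>)) = csize \<alpha>"
proof -
  have "mdegree (xmon is (parts \<alpha>)) = sum (Poly_Mapping.lookup (xmon is (parts \<alpha>))) (set is)"
    using keys_xmon[of "is" "parts \<alpha>"] assms parts_pos by (simp add: mdegree_def clength.rep_eq)
  also have "\<dots> = sum_list (map (Poly_Mapping.lookup (xmon is (parts \<alpha>))) is)"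
    using assms strict_sorted_iff by (intro sum.distinct_set_conv_list) auto
  finally show ?thesis
    using map_lookup_xmon[of "is" "parts \<alpha>"] assms by (simp add: clength.rep_eq csize.rep_eq)
qed

lemma mcoeff_M:
  assumes "sorted_wrt (<) is" "length is = clength \<beta>"
  shows "mcoeff (M \<alpha>) (xmon is (parts \<beta>)) = of_bool (\<alpha> = \<beta>)"
proof -
  have "{js. length js = clength \<alpha> \<and> sorted_wrt (<) js \<and> xmon js (parts \<alpha>) = xmon is (parts \<beta>)} =
      (if \<alpha> = \<beta> then {is} else {})"
    (is "?S = _")
  proof -
    have 1: "js = is \<and> \<alpha> = \<beta>" if "js \<in> ?S" for js
      using that assms xmon_eqD[of js "parts \<alpha>" "is" "parts \<beta>"] parts_pos[of \<alpha>] parts_pos[of \<beta>]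
      by (simp add: clength.rep_eq parts_inject)
    show ?thesis
    proof (cases "\<alpha> = \<beta>")
      case True
      then have "is \<in> ?S" using assms by simp
      moreover have "?S \<subseteq> {is}" by (rule subsetI) (drule 1, simp)
      ultimately have "?S = {is}" by (intro subset_antisym) (simp_all only: empty_subsetI insert_subset)
      with True show ?thesis by (simp only: refl if_True)
    next
      case False
      have "?S = {}"
      proof (rule equals0I)
        fix js assume "js \<in> ?S"
        from 1[OF this] False show False by simp
      qed
      with False show ?thesis by (simp only: if_False if_not_P)
    qed
  qed
  then show ?thesis by (simp add: M.rep_eq)
qed

lemma mcoeff_sum: "mcoeff (sum f A) m = (\<Sum>a\<in>A. mcoeff (f a) m)"
  by (induction A rule: infinite_finite_induct) (simp_all add: zero_mpowser.rep_eq plus_mpowser.rep_eq)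

lemma M_in_QSym_deg: "M \<alpha> \<in> QSym_deg (csize \<alpha>)"
proof -
  have "mdegree m = csize \<alpha>" if "mcoeff (M \<alpha>) m \<noteq> 0" for m
    using xmon_exists[of m] that
    by (metis mcoeff_M mdegree_xmon of_bool_eq(1))
  moreover have "M \<alpha> \<in> QSym"
    unfolding QSym_def
  proof (intro CollectI conjI allI impI)
    show "\<exists>d. \<forall>m. mcoeff (M \<alpha>) m \<noteq> 0 \<longrightarrow> mdegree m \<le> d"
      using calculation by (metis order_refl)
  qed (simp add: mcoeff_M)
  ultimately show ?thesis unfolding QSym_deg_def by blast
qed

lemma QSym_D:
  assumes "f \<in> QSym" "length is = clength \<alpha>" "length js = clength \<alpha>"
    "sorted_wrt (<) is" "sorted_wrt (<) js"
  shows "mcoeff f (xmon is (parts \<alpha>)) = mcoeff f (xmon js (parts \<alpha>))"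
  using assms unfolding QSym_def by blast

lemma subspace_QSym: "mpowser.subspace (QSym :: 'k::comm_ring_1 mpowser set)"
proof (rule mpowser.subspaceI)
  fix f g :: "'k mpowser" assume f: "f \<in> QSym" and g: "g \<in> QSym"
  obtain d e where d: "\<And>m. mcoeff f m \<noteq> 0 \<Longrightarrow> mdegree m \<le> d" "\<And>m. mcoeff g m \<noteq> 0 \<Longrightarrow> mdegree m \<le> e"
    using f g unfolding QSym_def by blast
  have "mdegree m \<le> max d e" if "mcoeff (f + g) m \<noteq> 0" for m
    using d[of m] that by (cases "mcoeff f m = 0") (auto simp: plus_mpowser.rep_eq)
  moreover have "mcoeff (f + g) (xmon is (parts \<alpha>)) = mcoeff (f + g) (xmon js (parts \<alpha>))"
    if "length is = clength \<alpha>" "length js = clength \<alpha>" "sorted_wrt (<) is" "sorted_wrt (<) js" for \<alpha> "is" js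
    using QSym_D[OF f that] QSym_D[OF g that] by (simp add: plus_mpowser.rep_eq)
  ultimately show "f + g \<in> QSym" unfolding QSym_def by blast
next
  fix f :: "'k mpowser" and c assume f: "f \<in> QSym"
  obtain d where d: "\<And>m. mcoeff f m \<noteq> 0 \<Longrightarrow> mdegree m \<le> d"
    using f unfolding QSym_def by blast
  have "mdegree m \<le> d" if "mcoeff (mscale c f) m \<noteq> 0" for m
    using d[of m] that by (cases "mcoeff f m = 0") (auto simp: mscale.rep_eq)
  moreover have "mcoeff (mscale c f) (xmon is (parts \<alpha>)) = mcoeff (mscale c f) (xmon js (parts \<alpha>))"
    if "length is = clength \<alpha>" "length js = clength \<alpha>" "sorted_wrt (<) is" "sorted_wrt (<) js" for \<alpha> "is" js
    using QSym_D[OF f that] by (simp add: mscale.rep_eq)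
  ultimately show "mscale c f \<in> QSym" unfolding QSym_def by blast
next
  have "mcoeff (0 :: 'k mpowser) m = 0" for m
    by (simp add: zero_mpowser.rep_eq)
  then show "(0 :: 'k mpowser) \<in> QSym"
    unfolding QSym_def by (intro CollectI conjI exI[of _ 0] allI impI) simp_all
qed

lemma M_basis: "mpowser.basis_family UNIV (M :: composition \<Rightarrow> 'k::comm_ring_1 mpowser) QSym"
proof -
  let ?M = "M :: composition \<Rightarrow> 'k mpowser"
  define x where "x \<alpha> = xmon [0..<clength \<alpha>] (parts \<alpha>)" for \<alpha>
  have x: "mcoeff (?M \<alpha>) (x \<beta>) = of_bool (\<alpha> = \<beta>)" for \<alpha> \<beta>
    unfolding x_def by (rule mcoeff_M) simp_all
  have inj: "inj ?M"
    by (rule injI) (metis x of_bool_eq_iff)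
  have "mpowser.independent (range ?M)"
    unfolding mpowser.independent_explicit_module
  proof (intro allI impI)
    fix t :: "'k mpowser set" and u v
    assume t: "finite t" "t \<subseteq> range ?M" and z: "(\<Sum>v\<in>t. mscale (u v) v) = 0" and v: "v \<in> t"
    then obtain \<alpha> where \<alpha>: "v = M \<alpha>" by blast
    have "0 = mcoeff (\<Sum>v\<in>t. mscale (u v) v) (x \<alpha>)" by (simp add: z zero_mpowser.rep_eq)
    also have "\<dots> = (\<Sum>w\<in>t. if w = v then u v else 0)"
      unfolding mcoeff_sum
    proof (rule sum.cong)
      fix w assume "w \<in> t"
      then obtain \<beta> where "w = M \<beta>" using t by blast
      then show "mcoeff (mscale (u w) w) (x \<alpha>) = (if w = v then u v else 0)"
        using inj by (auto simp: \<alpha> mscale.rep_eq x dest: injD)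
    qed simp
    also have "\<dots> = u v" using t v by simp
    finally show "u v = 0" by simp
  qed
  moreover have "mpowser.span (range ?M) = QSym"
  proof (rule mpowser.span_subspace)
    show "range ?M \<subseteq> QSym" using M_in_QSym_deg by (auto simp: QSym_deg_def)
    show "mpowser.subspace QSym" by (rule subspace_QSym)
    show "QSym \<subseteq> mpowser.span (range ?M)"
    proof
      fix f :: "'k mpowser" assume f: "f \<in> QSym"
      then obtain d where d: "\<And>m. mcoeff f m \<noteq> 0 \<Longrightarrow> mdegree m \<le> d" unfolding QSym_def by blast
      let ?A = "\<Union>n\<le>d. Comp n"
      have "f = (\<Sum>\<alpha>\<in>?A. mscale (mcoeff f (x \<alpha>)) (M \<alpha>))"
      proof (rule mpowser_eqI)
        fix m
        obtain "is" \<beta> where m: "sorted_wrt (<) is" "length is = clength \<beta>" "m = xmon is (parts \<beta>)"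
          by (rule xmon_exists)
        have "mcoeff f m = mcoeff f (x \<beta>)"
          unfolding m(3) x_def by (rule QSym_D[OF f]) (simp_all add: m)
        moreover have "mcoeff f m = 0" if "\<beta> \<notin> ?A"
        proof (rule ccontr)
          assume "mcoeff f m \<noteq> 0"
          from d[OF this] have "csize \<beta> \<le> d" unfolding m(3) mdegree_xmon[OF m(1,2)] .
          with that show False by (simp add: Comp_def)
        qed
        moreover have "finite ?A" using finite_Comp by simp
        then have "(\<Sum>\<alpha>\<in>?A. if \<alpha> = \<beta> then mcoeff f (x \<beta>) else 0) =
            (if \<beta> \<in> ?A then mcoeff f (x \<beta>) else 0)"
          by (rule sum.delta)
        moreover have "mcoeff (\<Sum>\<alpha>\<in>?A. mscale (mcoeff f (x \<alpha>)) (M \<alpha>)) m =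
            (\<Sum>\<alpha>\<in>?A. if \<alpha> = \<beta> then mcoeff f (x \<beta>) else 0)"
          unfolding mcoeff_sum m(3)
          by (intro sum.cong refl) (simp add: mscale.rep_eq mcoeff_M[OF m(1,2)])
        ultimately show "mcoeff f m = mcoeff (\<Sum>\<alpha>\<in>?A. mscale (mcoeff f (x \<alpha>)) (M \<alpha>)) m"
          by metis
      qed
      moreover have "\<dots> \<in> mpowser.span (range ?M)"
        by (intro mpowser.span_sum mpowser.span_scale mpowser.span_base rangeI)
      ultimately show "f \<in> mpowser.span (range ?M)" by (rule ssubst)
    qed
  qed
  ultimately show ?thesis using inj by (simp add: mpowser.basis_family_def)
qed

text \<open>The bilinear extension of \<open>\<langle>H\<^sub>\<alpha>, M\<^sub>\<beta>\<rangle> = [\<alpha> = \<beta>]\<close>, by expansion in the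
  bases \<open>H\<close> and \<open>M\<close>. Values outside \<^const>\<open>QSym\<close> are junk.\<close>

definition pairing :: "'k nsym \<Rightarrow> 'k mpowser \<Rightarrow> 'k::comm_ring_1" where
  "pairing x f = (\<Sum>\<alpha> | nsym.representation (range H) x (H \<alpha>) \<noteq> 0.
     \<Sum>\<beta> | mpowser.representation (range M) f (M \<beta>) \<noteq> 0.
       nsym.representation (range H) x (H \<alpha>) * mpowser.representation (range M) f (M \<beta>) *
         of_bool (\<alpha> = \<beta>))"

lemma pairing_H_M: "pairing (H \<alpha>) (M \<beta>) = (of_bool (\<alpha> = \<beta>) :: 'k::comm_ring_1)"
proof -
  let ?H = "H :: composition \<Rightarrow> 'k nsym" and ?M = "M :: composition \<Rightarrow> 'k mpowser"
  have H: "inj ?H" "nsym.independent (range ?H)" and M: "inj ?M" "mpowser.independent (range ?M)"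
    using H_basis M_basis by (auto simp: nsym.basis_family_def mpowser.basis_family_def)
  have "nsym.representation (range ?H) (?H \<alpha>) (?H \<gamma>) = of_bool (\<gamma> = \<alpha>)" for \<gamma>
    using nsym.representation_basis[OF H(2), of "?H \<alpha>"] inj_eq[OF H(1)] by simp
  moreover have "mpowser.representation (range ?M) (?M \<beta>) (?M \<gamma>) = of_bool (\<gamma> = \<beta>)" for \<gamma>
    using mpowser.representation_basis[OF M(2), of "?M \<beta>"] inj_eq[OF M(1)] by simp
  ultimately show ?thesis by (simp add: pairing_def)
qed

lemma pairing_eq:
  fixes f :: "'k::comm_ring_1 mpowser"
  assumes "f \<in> QSym" "finite A" "\<And>\<alpha>. \<alpha> \<notin> A \<Longrightarrow> nsym.representation (range H) x (H \<alpha>) = 0"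
  shows "pairing x f = (\<Sum>\<alpha>\<in>A. nsym.representation (range H) x (H \<alpha>) *
    mpowser.representation (range M) f (M \<alpha>))"
proof -
  let ?a = "\<lambda>\<alpha>. nsym.representation (range H) x (H \<alpha>)"
  let ?b = "\<lambda>\<alpha>. mpowser.representation (range M) f (M \<alpha>)"
  have fin: "finite {\<beta>. ?b \<beta> \<noteq> 0}"
  proof (rule finite_imageD)
    show "finite ((M :: composition \<Rightarrow> 'k mpowser) ` {\<beta>. ?b \<beta> \<noteq> 0})"
      by (rule finite_subset[OF _ mpowser.finite_representation[of "range M" f]]) auto
    show "inj_on (M :: composition \<Rightarrow> 'k mpowser) {\<beta>. ?b \<beta> \<noteq> 0}"
      using M_basis by (auto simp: mpowser.basis_family_def intro: inj_on_subset)
  qed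
  have "pairing x f = (\<Sum>\<alpha> | ?a \<alpha> \<noteq> 0. ?a \<alpha> * ?b \<alpha>)"
    unfolding pairing_def by (rule sum.cong) (use fin in \<open>auto simp: of_bool_def if_distrib cong: if_cong\<close>)
  also have "\<dots> = (\<Sum>\<alpha>\<in>A. ?a \<alpha> * ?b \<alpha>)"
    using assms by (intro sum.mono_neutral_left) auto
  finally show ?thesis .
qed

lemma finite_representation_H:
  fixes x :: "'k::comm_ring_1 nsym"
  shows "finite {\<alpha>. nsym.representation (range H) x (H \<alpha>) \<noteq> 0}"
proof (rule finite_imageD)
  show "finite ((H :: composition \<Rightarrow> 'k nsym) ` {\<alpha>. nsym.representation (range H) x (H \<alpha>) \<noteq> 0})"
    by (rule finite_subset[OF _ nsym.finite_representation[of "range H" x]]) auto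
  show "inj_on (H :: composition \<Rightarrow> 'k nsym) {\<alpha>. nsym.representation (range H) x (H \<alpha>) \<noteq> 0}"
    using H_basis by (auto simp: nsym.basis_family_def intro: inj_on_subset)
qed

lemma pairing_bilinear:
  assumes f: "f \<in> QSym" and g: "g \<in> QSym"
  shows "pairing (x + y) f = pairing x f + pairing y f"
    and "pairing (nscale c x) f = c * pairing x f"
    and "pairing x (f + g) = pairing x f + pairing x g"
    and "pairing x (mscale c f) = c * pairing x f"
proof -
  let ?R = "nsym.representation (range H)"
  have H: "nsym.independent (range H)" "\<And>z. z \<in> nsym.span (range H)"
    using H_basis by (auto simp: nsym.basis_family_def)
  have M: "mpowser.independent (range M)" "mpowser.span (range M) = QSym"
    using M_basis by (auto simp: mpowser.basis_family_def)
  define A where "A = {\<alpha>. ?R x (H \<alpha>) \<noteq> 0} \<union> {\<alpha>. ?R y (H \<alpha>) \<noteq> 0}"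
  have fA: "finite A" by (simp add: A_def finite_representation_H)
  have A: "?R x (H \<alpha>) = 0" "?R y (H \<alpha>) = 0" if "\<alpha> \<notin> A" for \<alpha>
    using that by (auto simp: A_def)
  note add = nsym.representation_add[OF H(1) H(2) H(2)] nsym.representation_scale[OF H(1) H(2)]
  note eq = pairing_eq[OF _ fA]
  show "pairing (x + y) f = pairing x f + pairing y f"
    using f A by (simp add: eq add algebra_simps sum.distrib)
  show "pairing (nscale c x) f = c * pairing x f"
    using f A by (simp add: eq add algebra_simps sum_distrib_left)
  show "pairing x (f + g) = pairing x f + pairing x g"
    using f g A mpowser.subspace_add[OF subspace_QSym f g]
    by (simp add: eq mpowser.representation_add[OF M(1)] M(2) algebra_simps sum.distrib)
  show "pairing x (mscale c f) = c * pairing x f"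
    using f A mpowser.subspace_scale[OF subspace_QSym f]
    by (simp add: eq mpowser.representation_scale[OF M(1)] M(2) algebra_simps sum_distrib_left)
qed

text \<open>The given \<open>v\<close> is a basis of \<open>V \<subseteq> NSym\<close>, dual to the basis \<open>w\<close> of \<open>W \<subseteq> QSym\<close>.\<close>

definition dual_basis ::
    "composition set \<Rightarrow> (composition \<Rightarrow> 'k::comm_ring_1 nsym) \<Rightarrow> 'k nsym set \<Rightarrow>
      (composition \<Rightarrow> 'k mpowser) \<Rightarrow> 'k mpowser set \<Rightarrow> bool" where
  "dual_basis I v V w W \<longleftrightarrow>
     nsym.basis_family I v V \<and> mpowser.basis_family I w W \<and>
     (\<forall>\<alpha>\<in>I. \<forall>\<beta>\<in>I. pairing (v \<alpha>) (w \<beta>) = of_bool (\<alpha> = \<beta>))"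

definition graded_basis_NSym :: "(composition \<Rightarrow> 'k::comm_ring_1 nsym) \<Rightarrow> bool" where
  "graded_basis_NSym v \<longleftrightarrow>
     nsym.basis_family UNIV v UNIV \<and> (\<forall>n. nsym.basis_family (Comp n) v (NSym_deg n))"


section \<open>The two families\<close>

definition ring_inv :: "'k::comm_ring_1 \<Rightarrow> 'k" where
  "ring_inv r = (THE s. r * s = 1)"

lemma ring_inv:
  assumes "r dvd 1"
  shows "r * ring_inv r = 1"
proof -
  obtain s where s: "r * s = 1" using assms by (metis dvdE)
  have "t = s" if "r * t = 1" for t
    using that s by (metis mult.left_commute mult.right_neutral)
  then show ?thesis unfolding ring_inv_def using s by (metis (mono_tags, lifting) theI')
qed

definition eta :: "'k::comm_ring_1 \<Rightarrow> composition \<Rightarrow> 'k mpowser" where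
  "eta q \<alpha> = (let r = q + 1 in
     \<Sum>\<beta> | \<beta> \<in> Comp (csize \<alpha>) \<and> D \<beta> \<subseteq> D \<alpha>. mscale (r ^ clength \<beta>) (M \<beta>))"

text \<open>If \<open>\<alpha>\<close> and \<open>\<beta>\<close> have the same size and \<open>D \<alpha> \<subseteq> D \<beta>\<close> then
  \<open>clength \<alpha> \<le> clength \<beta>\<close>, so the subtraction does not truncate.\<close>

definition eta_star :: "'k::comm_ring_1 \<Rightarrow> composition \<Rightarrow> 'k nsym" where
  "eta_star q \<alpha> = (let r = q + 1 in
     \<Sum>\<beta> | \<beta> \<in> Comp (csize \<alpha>) \<and> D \<alpha> \<subseteq> D \<beta>.
       nscale (ring_inv (r ^ clength \<beta>) * (-1) ^ (clength \<beta> - clength \<alpha>)) (H \<beta>))"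

end

theory Submission
  imports Defs
begin

text \<open>
  Sending a composition \<open>\<alpha>\<close> to \<open>D \<alpha>\<close> identifies the compositions of \<open>n\<close> with the subsets of
  \<open>[n - 1]\<close>, and up to the shift by one the length of \<open>\<alpha>\<close> is the cardinality of \<open>D \<alpha>\<close>
  (\<open>bij_betw_D\<close>, \<open>card_D_diff\<close>). The refinement order on compositions of \<open>n\<close> is therefore a Boolean
  lattice, and an alternating sum over an interval of it vanishes unless the interval is a single
  point (\<open>alternating_sum_refinements\<close>). Everything rests on this cancellation.

  Write \<open>r = q + 1\<close>. In the pairing of \<open>eta_star q \<alpha>\<close> with \<open>eta q \<beta>\<close> only the compositions \<open>\<gamma>\<close> with
  \<open>D \<alpha> \<subseteq> D \<gamma> \<subseteq> D \<beta>\<close> contribute; the powers of \<open>r\<close> and of its inverse cancel, and the signs that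
  remain form such an alternating sum. This gives \<open>pairing_eta_star_eta\<close>, and two families that are
  dual to each other are automatically linearly independent (\<open>dual_functionals_independent\<close>).

  Duality alone does not make the families span, but the same cancellation inverts both
  definitions: \<open>H\<^bsub>\<gamma>\<^esub>\<close> is a multiple of the sum of the \<open>eta_star q \<alpha>\<close> over the refinements \<open>\<alpha>\<close>
  of \<open>\<gamma>\<close> (\<open>sum_eta_star_refinements\<close>), and
  \<open>M\<^bsub>\<gamma>\<^esub>\<close> is a multiple of a signed sum of the \<open>eta q \<alpha>\<close> over the coarsenings \<open>\<alpha>\<close> of \<open>\<gamma>\<close>
  (\<open>alternating_sum_eta\<close>). These formulas stay within one degree, so a single argument covers
  both the whole modules and their graded components (\<open>dual_basis_eta\<close>).
\<close>

section \<open>Compositions of \<open>n\<close> as subsets of \<open>[n - 1]\<close>\<close>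

text \<open>
  \<^const>\<open>D\<close> on plain lists: unlike compositions, these admit structural induction.
\<close>

definition partial_sums :: "nat list \<Rightarrow> nat set" where
  "partial_sums xs = (\<lambda>i. sum_list (take i xs)) ` {1..length xs - 1}"

lemma D_eq_partial_sums: "D \<alpha> = partial_sums (parts \<alpha>)"
  by (simp add: D_def partial_sums_def clength.rep_eq Setcompr_eq_image flip: atLeastAtMost_iff)

lemma partial_sums_short: "length xs \<le> 1 \<Longrightarrow> partial_sums xs = {}"
  by (auto simp: partial_sums_def)

lemma partial_sums_Cons:
  assumes "xs \<noteq> []"
  shows "partial_sums (x # xs) = insert x ((+) x ` partial_sums xs)"
proof -
  let ?s = "\<lambda>i. sum_list (take i (x # xs))"
  have "{1..length (x # xs) - 1} = insert 1 (Suc ` {1..length xs - 1})"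
    using assms by (cases xs) auto
  then have "partial_sums (x # xs) = ?s ` insert 1 (Suc ` {1..length xs - 1})"
    unfolding partial_sums_def by (rule arg_cong)
  also have "\<dots> = insert x ((+) x ` partial_sums xs)"
    by (simp add: partial_sums_def image_image del: image_Suc_atLeastAtMost)
  finally show ?thesis .
qed

lemma sum_list_eq_0_iff_Nil: "0 \<notin> set xs \<Longrightarrow> sum_list (xs :: nat list) = 0 \<longleftrightarrow> xs = []"
  by (cases xs) auto

lemma partial_sums_subset: "0 \<notin> set xs \<Longrightarrow> partial_sums xs \<subseteq> {1..<sum_list xs}"
proof (induction xs)
  case (Cons x xs)
  show ?case
  proof (cases "xs = []")
    case False
    then show ?thesis
      using Cons sum_list_eq_0_iff_Nil[of xs]
      by (auto simp: partial_sums_Cons simp del: sum_list_eq_0_iff)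
  qed (simp add: partial_sums_short)
qed (simp add: partial_sums_short)

lemma card_partial_sums: "0 \<notin> set xs \<Longrightarrow> card (partial_sums xs) = length xs - 1"
proof (induction xs)
  case (Cons x xs)
  show ?case
  proof (cases "xs = []")
    case False
    have s: "partial_sums xs \<subseteq> {1..<sum_list xs}"
      using Cons by (intro partial_sums_subset) simp
    then have "x \<notin> (+) x ` partial_sums xs" "finite (partial_sums xs)"
      by (auto intro: finite_subset)
    then show ?thesis
      using Cons False by (cases xs) (auto simp: partial_sums_Cons card_image)
  qed (simp add: partial_sums_short)
qed (simp add: partial_sums_short)

text \<open>
  The cardinality of the set of partial sums gives the length. For two or more entries the smallest
  partial sum is the first entry, and the others, shifted down by it, are the partial sums of the
  tail.
\<close>

lemma partial_sums_inject:
  assumes "0 \<notin> set xs" "0 \<notin> set ys" "sum_list xs = sum_list ys" "partial_sums xs = partial_sums ys"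
  shows "xs = ys"
  using assms
proof (induction xs arbitrary: ys)
  case Nil
  then show ?case by (metis sum_list.Nil sum_list_eq_0_iff_Nil)
next
  case (Cons x xs)
  obtain y ys' where ys: "ys = y # ys'"
    using Cons.prems(1,3) by (cases ys) simp_all
  have len: "length xs = length ys'"
  proof -
    have "length (x # xs) - 1 = length ys - 1"
      using Cons.prems(1,2,4) card_partial_sums by metis
    then show ?thesis by (simp add: ys)
  qed
  show ?case
  proof (cases "xs = []")
    case True
    then show ?thesis using len Cons.prems by (simp add: ys)
  next
    case False
    have ne: "ys' \<noteq> []" using False len by auto
    have P: "insert x ((+) x ` partial_sums xs) = insert y ((+) y ` partial_sums ys')"
      using Cons.prems(4) False ne by (simp add: ys partial_sums_Cons)
    have "x \<in> insert y ((+) y ` partial_sums ys')" "y \<in> insert x ((+) x ` partial_sums xs)"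
      using P by blast+
    then have "y \<le> x" "x \<le> y" by auto
    then have xy: "x = y" by simp
    moreover have "(+) x ` partial_sums xs = (+) x ` partial_sums ys'"
    proof -
      have "0 \<notin> partial_sums xs" "0 \<notin> partial_sums ys'"
        using partial_sums_subset[of xs] partial_sums_subset[of ys'] Cons.prems by (auto simp: ys)
      then have "x \<notin> (+) x ` partial_sums xs" "x \<notin> (+) x ` partial_sums ys'"
        by auto
      then show ?thesis using P by (metis insert_ident xy)
    qed
    then have "partial_sums xs = partial_sums ys'"
      by (simp add: inj_image_eq_iff)
    then have "xs = ys'" using Cons.prems xy by (intro Cons.IH) (auto simp: ys)
    ultimately show ?thesis by (simp add: ys)
  qed
qed

text \<open>
  The list is built greedily: its first entry is the least element of \<open>S\<close>, and the remaining
  elements, shifted down by it, determine the tail.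
\<close>

lemma partial_sums_surject:
  assumes "S \<subseteq> {1..<n}"
  shows "\<exists>xs. 0 \<notin> set xs \<and> sum_list xs = n \<and> partial_sums xs = S"
  using assms
proof (induction n arbitrary: S rule: less_induct)
  case (less n)
  show ?case
  proof (cases "S = {}")
    case True
    then show ?thesis
      by (intro exI[of _ "if n = 0 then [] else [n]"]) (simp add: partial_sums_short)
  next
    case False
    define x where "x = Min S"
    have fin: "finite S" using less.prems finite_subset by blast
    have x: "x \<in> S" "\<And>s. s \<in> S \<Longrightarrow> x \<le> s"
      using fin False by (auto simp: x_def)
    then have x1: "1 \<le> x" "x < n" using less.prems by auto
    define T where "T = (\<lambda>s. s - x) ` (S - {x})"
    have S: "insert x ((+) x ` T) = S"
      using x by (force simp: T_def image_image)
    have "T \<subseteq> {1..<n - x}"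
    proof
      fix t assume "t \<in> T"
      then obtain s where s: "s \<in> S" "s \<noteq> x" "t = s - x" by (auto simp: T_def)
      then show "t \<in> {1..<n - x}" using x(2)[OF s(1)] less.prems by fastforce
    qed
    then obtain xs where xs: "0 \<notin> set xs" "sum_list xs = n - x" "partial_sums xs = T"
      using less.IH[of "n - x"] x1 by auto
    then have "xs \<noteq> []" using x1 by auto
    then show ?thesis
      using xs x1 S by (intro exI[of _ "x # xs"]) (simp add: partial_sums_Cons)
  qed
qed

lemma bij_betw_D: "bij_betw D (Comp n) (Pow {1..<n})"
  unfolding bij_betw_def
proof
  show "inj_on D (Comp n)"
    by (rule inj_onI)
      (metis (mono_tags, lifting) Comp_def D_eq_partial_sums csize.rep_eq mem_Collect_eq
        partial_sums_inject parts_inject parts_pos)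
  show "D ` Comp n = Pow {1..<n}"
  proof (intro subset_antisym subsetI)
    fix S assume "S \<in> D ` Comp n"
    then show "S \<in> Pow {1..<n}"
      using partial_sums_subset[OF parts_pos]
      by (auto simp: Comp_def D_eq_partial_sums csize.rep_eq)
  next
    fix S assume "S \<in> Pow {1..<n}"
    then obtain xs where xs: "0 \<notin> set xs" "sum_list xs = n" "partial_sums xs = S"
      using partial_sums_surject[of S n] by auto
    then have "parts (Abs_composition xs) = xs" by (simp add: Abs_composition_inverse)
    then show "S \<in> D ` Comp n"
      using xs by (intro image_eqI[of _ _ "Abs_composition xs"])
        (simp_all add: D_eq_partial_sums Comp_def csize.rep_eq)
  qed
qed

text \<open>
  The length exceeds the cardinality of \<open>D\<close> by one, except for the empty composition, where both
  are zero. Within one size the two cases cannot mix, so differences agree.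
\<close>

lemma card_D_diff:
  assumes "csize \<alpha> = csize \<beta>"
  shows "card (D \<beta>) - card (D \<alpha>) = clength \<beta> - clength \<alpha>"
proof -
  have "parts \<alpha> = [] \<longleftrightarrow> parts \<beta> = []"
    using assms sum_list_eq_0_iff_Nil[OF parts_pos] by (metis csize.rep_eq)
  then show ?thesis
    by (cases "parts \<alpha> = []")
      (simp_all add: D_eq_partial_sums card_partial_sums[OF parts_pos] clength.rep_eq
        Suc_le_eq flip: length_greater_0_conv)
qed

lemma clength_mono:
  assumes "csize \<alpha> = csize \<beta>" "D \<alpha> \<subseteq> D \<beta>"
  shows "clength \<alpha> \<le> clength \<beta>"
proof -
  have "finite (D \<beta>)" by (simp add: D_def)
  then have "card (D \<alpha>) \<le> card (D \<beta>)" using assms by (intro card_mono)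
  then have "card (D \<alpha>) - card (D \<beta>) = 0" by simp
  then show ?thesis using card_D_diff[of \<beta> \<alpha>] assms by simp
qed


section \<open>Moebius inversion on the refinement order\<close>

text \<open>
  Removing \<open>A\<close> turns the interval into the power set of \<open>B - A\<close>; the signed sum over that power set
  is the expansion of \<open>\<Prod>x\<in>B - A. (-1 + 1)\<close>.
\<close>

lemma alternating_sum_interval:
  assumes "finite B"
  shows "(\<Sum>X | A \<subseteq> X \<and> X \<subseteq> B. (-1) ^ (card X - card A)) = (of_bool (A = B) :: 'k::comm_ring_1)"
proof (cases "A \<subseteq> B")
  case True
  have fin: "finite A" "finite (B - A)" using True assms finite_subset by auto
  have "(\<Sum>X | A \<subseteq> X \<and> X \<subseteq> B. (-1) ^ (card X - card A)) = (\<Sum>Y\<in>Pow (B - A). (-1 :: 'k) ^ card Y)"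
  proof (rule sum.reindex_bij_witness[of _ "\<lambda>Y. A \<union> Y" "\<lambda>X. X - A"])
    fix X assume "X \<in> {X. A \<subseteq> X \<and> X \<subseteq> B}"
    then show "(-1 :: 'k) ^ card (X - A) = (-1) ^ (card X - card A)"
      using fin by (simp add: card_Diff_subset)
  qed (use True in auto)
  also have "\<dots> = (\<Prod>x\<in>B - A. (-1) + 1)"
    using prod_add[OF fin(2), of "\<lambda>_. -1 :: 'k" "\<lambda>_. 1"] by simp
  also have "\<dots> = of_bool (A = B)"
    using True fin(2) by (simp add: power_0_left)
  finally show ?thesis .
next
  case False
  then have "{X. A \<subseteq> X \<and> X \<subseteq> B} = {}" "A \<noteq> B" by auto
  then show ?thesis by (simp only: sum.empty of_bool_eq)
qed

lemma alternating_sum_refinements: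
  assumes "\<alpha> \<in> Comp n" "\<beta> \<in> Comp n"
  shows "(\<Sum>\<gamma> | \<gamma> \<in> Comp n \<and> D \<alpha> \<subseteq> D \<gamma> \<and> D \<gamma> \<subseteq> D \<beta>. (-1) ^ (clength \<gamma> - clength \<alpha>)) =
    (of_bool (\<alpha> = \<beta>) :: 'k::comm_ring_1)"
proof -
  have inj: "inj_on D (Comp n)" and im: "D ` Comp n = Pow {1..<n}"
    using bij_betw_D[of n] by (auto simp: bij_betw_def)
  let ?S = "{\<gamma> \<in> Comp n. D \<alpha> \<subseteq> D \<gamma> \<and> D \<gamma> \<subseteq> D \<beta>}"
  have "D \<beta> \<subseteq> {1..<n}" using assms im by auto
  then have imS: "D ` ?S = {X. D \<alpha> \<subseteq> X \<and> X \<subseteq> D \<beta>}"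
  proof (intro subset_antisym subsetI)
    fix X assume X: "X \<in> {X. D \<alpha> \<subseteq> X \<and> X \<subseteq> D \<beta>}"
    then have "X \<in> D ` Comp n" using \<open>D \<beta> \<subseteq> {1..<n}\<close> unfolding im by blast
    then obtain \<gamma> where "\<gamma> \<in> Comp n" "X = D \<gamma>" by (rule imageE)
    then show "X \<in> D ` ?S" using X by simp
  qed auto
  have "(\<Sum>\<gamma>\<in>?S. (-1 :: 'k) ^ (clength \<gamma> - clength \<alpha>)) =
      (\<Sum>\<gamma>\<in>?S. (-1) ^ (card (D \<gamma>) - card (D \<alpha>)))"
    using assms(1) by (intro sum.cong refl) (simp add: Comp_def card_D_diff)
  also have "\<dots> = (\<Sum>X\<in>D ` ?S. (-1) ^ (card X - card (D \<alpha>)))"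
    using inj by (subst sum.reindex) (auto intro: inj_on_subset)
  also have "\<dots> = of_bool (D \<alpha> = D \<beta>)"
    unfolding imS by (rule alternating_sum_interval) (simp add: D_def)
  also have "D \<alpha> = D \<beta> \<longleftrightarrow> \<alpha> = \<beta>"
    using inj assms by (auto dest: inj_onD)
  finally show ?thesis .
qed

text \<open>
  Signs counted from the top of the interval differ from signs counted from the bottom by the
  constant factor \<open>(-1) ^ (clength \<beta> - clength \<alpha>)\<close>. Inverting the definitions of the two
  families calls for signs counted from the top.
\<close>

lemma alternating_sum_refinements':
  assumes "\<alpha> \<in> Comp n" "\<beta> \<in> Comp n"
  shows "(\<Sum>\<gamma> | \<gamma> \<in> Comp n \<and> D \<alpha> \<subseteq> D \<gamma> \<and> D \<gamma> \<subseteq> D \<beta>. (-1) ^ (clength \<beta> - clength \<gamma>)) =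
    (of_bool (\<alpha> = \<beta>) :: 'k::comm_ring_1)"
proof -
  let ?S = "{\<gamma>. \<gamma> \<in> Comp n \<and> D \<alpha> \<subseteq> D \<gamma> \<and> D \<gamma> \<subseteq> D \<beta>}"
  have "(-1 :: 'k) ^ (clength \<beta> - clength \<gamma>) =
      (-1) ^ (clength \<beta> - clength \<alpha>) * (-1) ^ (clength \<gamma> - clength \<alpha>)" if "\<gamma> \<in> ?S" for \<gamma>
  proof -
    have le: "clength \<alpha> \<le> clength \<gamma>" "clength \<gamma> \<le> clength \<beta>"
      using that assms by (auto simp: Comp_def intro!: clength_mono)
    then have "clength \<beta> - clength \<alpha> = (clength \<beta> - clength \<gamma>) + (clength \<gamma> - clength \<alpha>)"
      by simp
    then show ?thesis
      by (simp add: power_add mult.assoc flip: power_mult_distrib)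
  qed
  then have "(\<Sum>\<gamma>\<in>?S. (-1 :: 'k) ^ (clength \<beta> - clength \<gamma>)) =
      (-1) ^ (clength \<beta> - clength \<alpha>) * (\<Sum>\<gamma>\<in>?S. (-1) ^ (clength \<gamma> - clength \<alpha>))"
    by (simp add: sum_distrib_left)
  then show ?thesis
    using assms by (simp add: alternating_sum_refinements)
qed


section \<open>Bases from dual functionals\<close>

context module
begin

text \<open>
  Applying \<open>\<phi> i\<close> to a linear relation extracts the coefficient of \<open>v i\<close>. Linearity is asked for on a
  submodule \<open>S\<close> only, because the pairing is linear in its second argument only on quasisymmetric
  functions.
\<close>

lemma dual_functionals_independent:
  fixes \<phi> :: "'i \<Rightarrow> 'b \<Rightarrow> 'a"
  assumes S: "subspace S" "v ` I \<subseteq> S"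
    and add: "\<And>i x y. x \<in> S \<Longrightarrow> y \<in> S \<Longrightarrow> \<phi> i (x + y) = \<phi> i x + \<phi> i y"
    and scale: "\<And>i c x. x \<in> S \<Longrightarrow> \<phi> i (c *s x) = c * \<phi> i x"
    and dual: "\<And>i j. i \<in> I \<Longrightarrow> j \<in> I \<Longrightarrow> \<phi> i (v j) = of_bool (i = j)"
  shows "inj_on v I" and "independent (v ` I)"
proof -
  show inj: "inj_on v I"
  proof (rule inj_onI)
    fix i j assume ij: "i \<in> I" "j \<in> I" "v i = v j"
    then have "of_bool (i = j) = (1 :: 'a)" using dual[of i i] dual[of i j] by simp
    then show "i = j" by (cases "i = j") simp_all
  qed
  have zero: "\<phi> i 0 = 0" for i
    using scale[of 0 i 0] S(1) by (simp add: subspace_0)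
  have sum: "\<phi> i (\<Sum>x\<in>t. u x *s x) = (\<Sum>x\<in>t. u x * \<phi> i x)" if "finite t" "t \<subseteq> S" for i t u
    using that
  proof (induction t)
    case (insert x t)
    then have "(\<Sum>x\<in>t. u x *s x) \<in> S" "u x *s x \<in> S"
      using S(1) by (auto intro!: subspace_sum subspace_scale)
    with insert show ?case by (simp add: add scale)
  qed (simp add: zero)
  show "independent (v ` I)"
    unfolding independent_explicit_module
  proof (intro allI impI)
    fix t u w
    assume t: "finite t" "t \<subseteq> v ` I" and z: "(\<Sum>x\<in>t. u x *s x) = 0" and w: "w \<in> t"
    then obtain i where i: "i \<in> I" "w = v i" by blast
    have "0 = (\<Sum>x\<in>t. u x * \<phi> i x)"
      using sum[of t i u] t S(2) z zero by simp
    also have "\<dots> = (\<Sum>x\<in>t. if x = w then u x else 0)"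
    proof (rule sum.cong)
      fix x assume "x \<in> t"
      then obtain j where "j \<in> I" "x = v j" using t by blast
      then show "u x * \<phi> i x = (if x = w then u x else 0)"
        using i dual inj by (auto dest: inj_onD)
    qed simp
    also have "\<dots> = u w" using t w by simp
    finally show "u w = 0" by simp
  qed
qed

lemma span_eq_if_mutually_spanning:
  assumes "\<And>i. i \<in> I \<Longrightarrow> v i \<in> span (e ` I)" "\<And>i. i \<in> I \<Longrightarrow> e i \<in> span (v ` I)"
  shows "span (v ` I) = span (e ` I)"
  using assms by (auto simp: span_eq)

end


section \<open>Duality of the two families\<close>

lemma pairing_sum_left:
  assumes "f \<in> QSym"
  shows "pairing (\<Sum>a\<in>A. nscale (c a) (x a)) f = (\<Sum>a\<in>A. c a * pairing (x a) f)"
proof -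
  have "pairing 0 f = 0"
    using pairing_bilinear(2)[OF assms assms, of 0 0] by (simp add: nsym.scale_zero_left)
  then show ?thesis
    by (induction A rule: infinite_finite_induct) (simp_all add: pairing_bilinear[OF assms assms])
qed

lemma M_in_QSym: "M \<alpha> \<in> QSym"
  using M_in_QSym_deg by (auto simp: QSym_deg_def)

lemma pairing_sum_right:
  "pairing x (\<Sum>\<beta>\<in>A. mscale (c \<beta>) (M \<beta>)) = (\<Sum>\<beta>\<in>A. c \<beta> * pairing x (M \<beta>))"
proof -
  have "pairing x 0 = 0"
    using pairing_bilinear(4)[OF M_in_QSym M_in_QSym, of x 0] by (simp add: mpowser.scale_zero_left)
  moreover have "(\<Sum>\<beta>\<in>A. mscale (c \<beta>) (M \<beta>)) \<in> QSym" for A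
    by (intro mpowser.subspace_sum[OF subspace_QSym] mpowser.subspace_scale[OF subspace_QSym] M_in_QSym)
  moreover have "mscale (c \<beta>) (M \<beta>) \<in> QSym" for \<beta>
    by (intro mpowser.subspace_scale[OF subspace_QSym] M_in_QSym)
  ultimately show ?thesis
    by (induction A rule: infinite_finite_induct)
      (simp_all add: pairing_bilinear(3) pairing_bilinear(4)[OF M_in_QSym M_in_QSym])
qed

lemma eta_in_QSym: "eta q \<alpha> \<in> QSym"
  unfolding eta_def Let_def
  by (intro mpowser.subspace_sum[OF subspace_QSym] mpowser.subspace_scale[OF subspace_QSym] M_in_QSym)

lemma pairing_H_eta:
  "pairing (H \<gamma>) (eta q \<beta>) =
    (if \<gamma> \<in> Comp (csize \<beta>) \<and> D \<gamma> \<subseteq> D \<beta> then (q + 1) ^ clength \<gamma> else 0)"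
proof -
  have "pairing (H \<gamma>) (eta q \<beta>) =
      (\<Sum>\<delta> | \<delta> \<in> Comp (csize \<beta>) \<and> D \<delta> \<subseteq> D \<beta>. if \<delta> = \<gamma> then (q + 1) ^ clength \<gamma> else 0)"
    unfolding eta_def Let_def pairing_sum_right pairing_H_M by (rule sum.cong) auto
  then show ?thesis by (simp add: finite_Comp)
qed

lemma unit_power_ring_inv: "r dvd 1 \<Longrightarrow> r ^ n * ring_inv (r ^ n) = 1"
  by (rule ring_inv) (metis dvd_power_same power_one)

text \<open>
  Expanding both families leaves a sum over \<open>D \<alpha> \<subseteq> D \<gamma> \<subseteq> D \<beta>\<close> in which \<open>r ^ clength \<gamma>\<close> meets its
  inverse, so only the signs survive.
\<close>

lemma pairing_eta_star_eta:
  fixes q :: "'k::comm_ring_1"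
  assumes q: "(q + 1) dvd 1"
  shows "pairing (eta_star q \<alpha>) (eta q \<beta>) = of_bool (\<alpha> = \<beta>)"
proof -
  let ?c = "\<lambda>\<gamma>. ring_inv ((q + 1) ^ clength \<gamma>) * (-1) ^ (clength \<gamma> - clength \<alpha>)"
  let ?A = "{\<gamma>. \<gamma> \<in> Comp (csize \<alpha>) \<and> D \<alpha> \<subseteq> D \<gamma>}"
  have pair: "pairing (eta_star q \<alpha>) (eta q \<beta>) = (\<Sum>\<gamma>\<in>?A. ?c \<gamma> * pairing (H \<gamma>) (eta q \<beta>))"
    unfolding eta_star_def Let_def by (rule pairing_sum_left[OF eta_in_QSym])
  show ?thesis
  proof (cases "csize \<alpha> = csize \<beta>")
    case True
    have "pairing (eta_star q \<alpha>) (eta q \<beta>) =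
        (\<Sum>\<gamma>\<in>?A. if D \<gamma> \<subseteq> D \<beta> then (-1) ^ (clength \<gamma> - clength \<alpha>) else 0)"
      unfolding pair
    proof (rule sum.cong)
      fix \<gamma> assume "\<gamma> \<in> ?A"
      have "?c \<gamma> * (q + 1) ^ clength \<gamma> = (-1) ^ (clength \<gamma> - clength \<alpha>)"
        using unit_power_ring_inv[OF q, of "clength \<gamma>"] by (metis mult.commute mult.left_commute mult_1_right)
      with \<open>\<gamma> \<in> ?A\<close> True show "?c \<gamma> * pairing (H \<gamma>) (eta q \<beta>) =
          (if D \<gamma> \<subseteq> D \<beta> then (-1) ^ (clength \<gamma> - clength \<alpha>) else 0)"
        by (simp add: pairing_H_eta)
    qed simp
    also have "\<dots> = (\<Sum>\<gamma> | \<gamma> \<in> Comp (csize \<alpha>) \<and> D \<alpha> \<subseteq> D \<gamma> \<and> D \<gamma> \<subseteq> D \<beta>.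
        (-1) ^ (clength \<gamma> - clength \<alpha>))"
      by (rule sum.mono_neutral_cong_right) (auto simp: finite_Comp)
    also have "\<dots> = of_bool (\<alpha> = \<beta>)"
      using True by (intro alternating_sum_refinements) (simp_all add: Comp_def)
    finally show ?thesis .
  next
    case False
    then show ?thesis
      unfolding pair by (auto simp: pairing_H_eta Comp_def intro!: sum.neutral)
  qed
qed


section \<open>The two families span\<close>

text \<open>
  Moebius inversion of the definition of \<^const>\<open>eta_star\<close>: after the two sums are exchanged, the
  coefficient of \<open>H\<^bsub>\<beta>\<^esub>\<close> is an alternating sum over the interval from \<open>\<gamma>\<close> to \<open>\<beta>\<close>.
\<close>

lemma sum_eta_star_refinements:
  fixes q :: "'k::comm_ring_1"
  assumes \<gamma>: "\<gamma> \<in> Comp n"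
  shows "(\<Sum>\<alpha> | \<alpha> \<in> Comp n \<and> D \<gamma> \<subseteq> D \<alpha>. eta_star q \<alpha>) =
    nscale (ring_inv ((q + 1) ^ clength \<gamma>)) (H \<gamma>)"
proof -
  let ?A = "{\<alpha>. \<alpha> \<in> Comp n \<and> D \<gamma> \<subseteq> D \<alpha>}"
  let ?i = "\<lambda>\<beta>. ring_inv ((q + 1) ^ clength \<beta>)"
  let ?s = "\<lambda>\<alpha> \<beta>. (-1 :: 'k) ^ (clength \<beta> - clength \<alpha>)"
  have "(\<Sum>\<alpha>\<in>?A. eta_star q \<alpha>) =
      (\<Sum>\<alpha>\<in>?A. \<Sum>\<beta> | \<beta> \<in> Comp n \<and> D \<alpha> \<subseteq> D \<beta>. nscale (?i \<beta> * ?s \<alpha> \<beta>) (H \<beta>))"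
    by (rule sum.cong) (simp_all add: eta_star_def Let_def Comp_def)
  also have "\<dots> = (\<Sum>\<beta>\<in>Comp n. \<Sum>\<alpha> | \<alpha> \<in> ?A \<and> D \<alpha> \<subseteq> D \<beta>. nscale (?i \<beta> * ?s \<alpha> \<beta>) (H \<beta>))"
    by (rule sum.swap_restrict) (simp_all add: finite_Comp)
  also have "\<dots> = (\<Sum>\<beta>\<in>Comp n. if \<beta> = \<gamma> then nscale (?i \<beta>) (H \<beta>) else 0)"
  proof (rule sum.cong)
    fix \<beta> assume \<beta>: "\<beta> \<in> Comp n"
    have "(\<Sum>\<alpha> | \<alpha> \<in> ?A \<and> D \<alpha> \<subseteq> D \<beta>. nscale (?i \<beta> * ?s \<alpha> \<beta>) (H \<beta>)) =
        nscale (?i \<beta> * (\<Sum>\<alpha> | \<alpha> \<in> Comp n \<and> D \<gamma> \<subseteq> D \<alpha> \<and> D \<alpha> \<subseteq> D \<beta>. ?s \<alpha> \<beta>)) (H \<beta>)"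
      by (simp add: sum_distrib_left nsym.scale_sum_left conj_assoc)
    then show "(\<Sum>\<alpha> | \<alpha> \<in> ?A \<and> D \<alpha> \<subseteq> D \<beta>. nscale (?i \<beta> * ?s \<alpha> \<beta>) (H \<beta>)) =
        (if \<beta> = \<gamma> then nscale (?i \<beta>) (H \<beta>) else 0)"
      unfolding alternating_sum_refinements'[OF \<gamma> \<beta>] by (auto simp: nsym.scale_zero_left)
  qed simp
  also have "\<dots> = nscale (?i \<gamma>) (H \<gamma>)" using \<gamma> by (simp add: finite_Comp)
  finally show ?thesis .
qed

text \<open>
  Moebius inversion of the definition of \<^const>\<open>eta\<close>. Here the definition carries no signs, so they
  appear in the inverse; the interval runs from \<open>\<beta>\<close> to \<open>\<gamma>\<close>.
\<close>

lemma alternating_sum_eta: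
  fixes q :: "'k::comm_ring_1"
  assumes \<gamma>: "\<gamma> \<in> Comp n"
  shows "(\<Sum>\<alpha> | \<alpha> \<in> Comp n \<and> D \<alpha> \<subseteq> D \<gamma>. mscale ((-1) ^ (clength \<gamma> - clength \<alpha>)) (eta q \<alpha>)) =
    mscale ((q + 1) ^ clength \<gamma>) (M \<gamma>)"
proof -
  let ?A = "{\<alpha>. \<alpha> \<in> Comp n \<and> D \<alpha> \<subseteq> D \<gamma>}"
  let ?r = "\<lambda>\<beta>. (q + 1) ^ clength \<beta>"
  let ?s = "\<lambda>\<alpha>. (-1 :: 'k) ^ (clength \<gamma> - clength \<alpha>)"
  have "(\<Sum>\<alpha>\<in>?A. mscale (?s \<alpha>) (eta q \<alpha>)) =
      (\<Sum>\<alpha>\<in>?A. \<Sum>\<beta> | \<beta> \<in> Comp n \<and> D \<beta> \<subseteq> D \<alpha>. mscale (?r \<beta> * ?s \<alpha>) (M \<beta>))"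
    by (rule sum.cong)
      (simp_all add: eta_def Let_def Comp_def mpowser.scale_sum_right mult.commute)
  also have "\<dots> = (\<Sum>\<beta>\<in>Comp n. \<Sum>\<alpha> | \<alpha> \<in> ?A \<and> D \<beta> \<subseteq> D \<alpha>. mscale (?r \<beta> * ?s \<alpha>) (M \<beta>))"
    by (rule sum.swap_restrict) (simp_all add: finite_Comp)
  also have "\<dots> = (\<Sum>\<beta>\<in>Comp n. if \<beta> = \<gamma> then mscale (?r \<beta>) (M \<beta>) else 0)"
  proof (rule sum.cong)
    fix \<beta> assume \<beta>: "\<beta> \<in> Comp n"
    have "(\<Sum>\<alpha> | \<alpha> \<in> ?A \<and> D \<beta> \<subseteq> D \<alpha>. mscale (?r \<beta> * ?s \<alpha>) (M \<beta>)) =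
        mscale (?r \<beta> * (\<Sum>\<alpha> | \<alpha> \<in> Comp n \<and> D \<beta> \<subseteq> D \<alpha> \<and> D \<alpha> \<subseteq> D \<gamma>. ?s \<alpha>)) (M \<beta>)"
      by (simp add: sum_distrib_left mpowser.scale_sum_left conj_ac)
    then show "(\<Sum>\<alpha> | \<alpha> \<in> ?A \<and> D \<beta> \<subseteq> D \<alpha>. mscale (?r \<beta> * ?s \<alpha>) (M \<beta>)) =
        (if \<beta> = \<gamma> then mscale (?r \<beta>) (M \<beta>) else 0)"
      unfolding alternating_sum_refinements'[OF \<beta> \<gamma>] by (auto simp: mpowser.scale_zero_left)
  qed simp
  also have "\<dots> = mscale (?r \<gamma>) (M \<gamma>)" using \<gamma> by (simp add: finite_Comp)
  finally show ?thesis .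
qed

text \<open>
  The condition on \<open>I\<close> says that \<open>I\<close> is a union of sets \<open>Comp n\<close>. It holds for \<open>UNIV\<close> and for each
  \<open>Comp n\<close>, so the graded and the ungraded claims are instances of the same lemmas.
\<close>

lemma span_eta_star:
  fixes q :: "'k::comm_ring_1"
  assumes q: "(q + 1) dvd 1" and I: "\<And>\<alpha>. \<alpha> \<in> I \<Longrightarrow> Comp (csize \<alpha>) \<subseteq> I"
  shows "nsym.span (eta_star q ` I) = nsym.span (H ` I)"
proof (rule nsym.span_eq_if_mutually_spanning)
  fix \<alpha> assume \<alpha>: "\<alpha> \<in> I"
  show "eta_star q \<alpha> \<in> nsym.span (H ` I)"
    unfolding eta_star_def Let_def
    using I[OF \<alpha>] by (intro nsym.span_sum nsym.span_scale nsym.span_base) auto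
  let ?r = "(q + 1) ^ clength \<alpha>"
  have "H \<alpha> = nscale ?r (nscale (ring_inv ?r) (H \<alpha>))"
    by (simp add: unit_power_ring_inv[OF q] del: nsym.scale_left_commute)
  also have "\<dots> = nscale ?r (\<Sum>\<beta> | \<beta> \<in> Comp (csize \<alpha>) \<and> D \<alpha> \<subseteq> D \<beta>. eta_star q \<beta>)"
    by (subst sum_eta_star_refinements) (simp_all add: Comp_def)
  also have "\<dots> \<in> nsym.span (eta_star q ` I)"
    using I[OF \<alpha>] by (intro nsym.span_sum nsym.span_scale nsym.span_base) auto
  finally show "H \<alpha> \<in> nsym.span (eta_star q ` I)" .
qed

lemma span_eta:
  fixes q :: "'k::comm_ring_1"
  assumes q: "(q + 1) dvd 1" and I: "\<And>\<alpha>. \<alpha> \<in> I \<Longrightarrow> Comp (csize \<alpha>) \<subseteq> I"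
  shows "mpowser.span (eta q ` I) = mpowser.span (M ` I)"
proof (rule mpowser.span_eq_if_mutually_spanning)
  fix \<alpha> assume \<alpha>: "\<alpha> \<in> I"
  show "eta q \<alpha> \<in> mpowser.span (M ` I)"
    unfolding eta_def Let_def
    using I[OF \<alpha>] by (intro mpowser.span_sum mpowser.span_scale mpowser.span_base) auto
  let ?r = "(q + 1) ^ clength \<alpha>"
  have "M \<alpha> = mscale (ring_inv ?r) (mscale ?r (M \<alpha>))"
    using unit_power_ring_inv[OF q, of "clength \<alpha>"] by (simp add: mult.commute)
  also have "\<dots> = mscale (ring_inv ?r) (\<Sum>\<beta> | \<beta> \<in> Comp (csize \<alpha>) \<and> D \<beta> \<subseteq> D \<alpha>.
      mscale ((-1) ^ (clength \<alpha> - clength \<beta>)) (eta q \<beta>))"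
    by (subst alternating_sum_eta) (simp_all add: Comp_def)
  also have "\<dots> \<in> mpowser.span (eta q ` I)"
    using I[OF \<alpha>] by (intro mpowser.span_sum mpowser.span_scale mpowser.span_base) auto
  finally show "M \<alpha> \<in> mpowser.span (eta q ` I)" .
qed

lemma dual_basis_eta:
  fixes q :: "'k::comm_ring_1"
  assumes q: "(q + 1) dvd 1" and I: "\<And>\<alpha>. \<alpha> \<in> I \<Longrightarrow> Comp (csize \<alpha>) \<subseteq> I"
  shows "dual_basis I (eta_star q) (nsym.span (H ` I)) (eta q) (mpowser.span (M ` I))"
proof -
  have "inj_on (eta_star q) I" "nsym.independent (eta_star q ` I)"
    by (rule nsym.dual_functionals_independent[where S = UNIV and v = "eta_star q" and I = I
          and \<phi> = "\<lambda>\<beta> x. pairing x (eta q \<beta>)"];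
        auto simp: pairing_bilinear[OF eta_in_QSym eta_in_QSym] pairing_eta_star_eta[OF q])+
  moreover have "inj_on (eta q) I" "mpowser.independent (eta q ` I)"
    by (rule mpowser.dual_functionals_independent[OF subspace_QSym, where v = "eta q" and I = I
          and \<phi> = "\<lambda>\<alpha>. pairing (eta_star q \<alpha>)"];
        auto simp: pairing_bilinear eta_in_QSym pairing_eta_star_eta[OF q])+
  ultimately show ?thesis
    using span_eta_star[OF q I] span_eta[OF q I] pairing_eta_star_eta[OF q]
    by (simp add: dual_basis_def nsym.basis_family_def mpowser.basis_family_def)
qed


section \<open>Graded components\<close>

lemma span_H_Comp: "nsym.span (H ` Comp n) = (NSym_deg n :: 'k::comm_ring_1 nsym set)"
proof (rule nsym.span_subspace)
  show "H ` Comp n \<subseteq> (NSym_deg n :: 'k nsym set)"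
    by (auto simp: NSym_deg_def H_eq_single Comp_def)
  show "nsym.subspace (NSym_deg n :: 'k nsym set)"
  proof (rule nsym.subspaceI)
    show "x + y \<in> NSym_deg n" if "x \<in> NSym_deg n" "y \<in> NSym_deg n" for x y :: "'k nsym"
      using that Poly_Mapping.keys_add[of x y] by (auto simp: NSym_deg_def)
    show "nscale c x \<in> NSym_deg n" if "x \<in> NSym_deg n" for c and x :: "'k nsym"
    proof -
      have "Poly_Mapping.keys (nscale c x) \<subseteq> Poly_Mapping.keys x"
        by (auto simp: in_keys_iff lookup_nscale intro: ccontr)
      then show ?thesis using that by (auto simp: NSym_deg_def)
    qed
  qed (simp add: NSym_deg_def)
  show "NSym_deg n \<subseteq> nsym.span (H ` Comp n :: 'k nsym set)"
  proof
    fix x :: "'k nsym" assume x: "x \<in> NSym_deg n"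
    have "(\<Sum>\<alpha>\<in>Poly_Mapping.keys x. nscale (Poly_Mapping.lookup x \<alpha>) (H \<alpha>)) \<in> nsym.span (H ` Comp n)"
      using x by (intro nsym.span_sum nsym.span_scale nsym.span_base) (auto simp: NSym_deg_def Comp_def)
    then show "x \<in> nsym.span (H ` Comp n)" by (simp flip: nsym_sum_single)
  qed
qed

text \<open>
  Projection to one degree. It fixes a homogeneous \<open>f\<close> and kills every \<open>M\<^bsub>\<alpha>\<^esub>\<close> of another size, which turns
  an expansion of \<open>f\<close> in all \<open>M\<^bsub>\<alpha>\<^esub>\<close> into one in those of the right size.
\<close>

lift_definition degree_part :: "nat \<Rightarrow> 'k mpowser \<Rightarrow> 'k::comm_ring_1 mpowser" is
  "\<lambda>n f m. if mdegree m = n then f m else 0" .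

lemma degree_part_M: "degree_part n (M \<alpha>) = (if \<alpha> \<in> Comp n then M \<alpha> else 0)"
  using M_in_QSym_deg[of \<alpha>]
  by (intro mpowser_eqI) (auto simp: degree_part.rep_eq QSym_deg_def Comp_def zero_mpowser.rep_eq)

lemma span_M_Comp: "mpowser.span (M ` Comp n) = (QSym_deg n :: 'k::comm_ring_1 mpowser set)"
proof (rule mpowser.span_subspace)
  show "M ` Comp n \<subseteq> (QSym_deg n :: 'k mpowser set)"
    using M_in_QSym_deg by (auto simp: Comp_def)
  show "mpowser.subspace (QSym_deg n :: 'k mpowser set)"
  proof (rule mpowser.subspaceI)
    show "f + g \<in> QSym_deg n" if "f \<in> QSym_deg n" "g \<in> QSym_deg n" for f g :: "'k mpowser"
      using that mpowser.subspace_add[OF subspace_QSym, of f g]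
      by (auto simp: QSym_deg_def plus_mpowser.rep_eq) (metis add_0)
    show "mscale c f \<in> QSym_deg n" if "f \<in> QSym_deg n" for c and f :: "'k mpowser"
    proof -
      have "mcoeff f m \<noteq> 0" if "mcoeff (mscale c f) m \<noteq> 0" for m
        using that by (auto simp: mscale.rep_eq)
      then show ?thesis
        using that mpowser.subspace_scale[OF subspace_QSym, of f c] by (simp add: QSym_deg_def)
    qed
  qed (simp add: QSym_deg_def mpowser.subspace_0[OF subspace_QSym] zero_mpowser.rep_eq)
  show "QSym_deg n \<subseteq> mpowser.span (M ` Comp n :: 'k mpowser set)"
  proof
    fix f :: "'k mpowser" assume f: "f \<in> QSym_deg n"
    then have "f \<in> mpowser.span (range M)"
      using M_basis by (auto simp: mpowser.basis_family_def QSym_deg_def)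
    then have "degree_part n f \<in> mpowser.span (M ` Comp n)"
    proof (induction rule: mpowser.span_induct_alt)
      case base
      have "degree_part n 0 = (0 :: 'k mpowser)"
        by (rule mpowser_eqI) (simp add: degree_part.rep_eq zero_mpowser.rep_eq)
      then show ?case by (simp add: mpowser.span_zero)
    next
      case (step c x y)
      then obtain \<alpha> where \<alpha>: "x = M \<alpha>" by blast
      have "degree_part n (mscale c x + y) = mscale c (degree_part n x) + degree_part n y"
        by (rule mpowser_eqI) (simp add: degree_part.rep_eq plus_mpowser.rep_eq mscale.rep_eq)
      moreover have "degree_part n x \<in> mpowser.span (M ` Comp n)"
        by (simp add: \<alpha> degree_part_M mpowser.span_base mpowser.span_zero)
      ultimately show ?case
        using step.IH by (simp add: mpowser.span_add mpowser.span_scale)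
    qed
    moreover have "degree_part n f = f"
      using f by (intro mpowser_eqI) (auto simp: degree_part.rep_eq QSym_deg_def)
    ultimately show "f \<in> mpowser.span (M ` Comp n)" by simp
  qed
qed

theorem proposition4p4:
  fixes q :: "'k::comm_ring_1"
  assumes "(q + 1) dvd 1"
  shows
    "(graded_basis_NSym (eta_star q) \<and> dual_basis UNIV (eta_star q) UNIV (eta q) QSym) \<and>
     (\<forall>n. dual_basis (Comp n) (eta_star q) (NSym_deg n) (eta q) (QSym_deg n))"
proof -
  have "nsym.span (range H) = (UNIV :: 'k nsym set)" "mpowser.span (range M) = (QSym :: 'k mpowser set)"
    using H_basis M_basis by (auto simp: nsym.basis_family_def mpowser.basis_family_def)
  then have all: "dual_basis UNIV (eta_star q) UNIV (eta q) QSym"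
    using dual_basis_eta[OF assms, of UNIV] by simp
  have deg: "dual_basis (Comp n) (eta_star q) (NSym_deg n) (eta q) (QSym_deg n)" for n
    unfolding span_H_Comp[symmetric] span_M_Comp[symmetric]
    by (rule dual_basis_eta[OF assms]) (simp add: Comp_def)
  have "graded_basis_NSym (eta_star q)"
    using all deg by (simp add: graded_basis_NSym_def dual_basis_def)
  with all deg show ?thesis by blast
qed

end
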